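(* Let $\Theta=\mathbb{R}^d$. Let $\{\phi_n\}_{n\in\mathbb{N}}$ be density functions on $\mathbb{R}^d$, $\{s_n\}$ positive numbers, and $\phi$ a density, such that: (1) each $\phi_n$ is log-concave; (2) $s_n\to\infty$; (3) $\phi_n(s_n\,\cdot)\to\phi(\cdot)$ in distribution; (4) $\phi$ is continuous on its support; (5) for every compact $\mathcal{X}\subset\Theta$, $\inf_{x\in\mathcal{X}}\phi(x)>0$. Fix a symmetric proposal kernel $L$ on $\Theta$ and define $L_n(x,A)=L(s_nx,s_nA)$. Let $K$ be the Metropolis-Hastings kernel with proposal $L$ and target $\phi$, and $K_n$ the Metropolis-Hastings kernel with proposal $L_n$ and target $\phi_n$. Fix $T\in\mathbb{N}$ and $x\in\Theta$, and let $\{X_t\}_{t=0}^T$, $\{Y_t\}_{t=0}^T$ be Markov chains driven by $K_n$ and $K$ respectively, started at $X_0=x/s_n$ and $Y_0=x$. Then for every measurable $A\subset\Theta^{T+1}$, $$\lim_{N_0\to\infty}\sup_{n\ge N_0}\big|\mathbb{P}[(s_nX_0,\dots,s_nX_T)\in A]-\mathbb{P}[(Y_0,\dots,Y_T)\in A]\big|=0.$$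
   Context: The Metropolis-Hastings kernel with symmetric proposal $Q$ and target density $g$: from $x$ draw $y\sim Q(x,\cdot)$ and move to $y$ with probability $\min(1,g(y)/g(x))$, otherwise stay at $x$.
   Formalization: Condition (3) is taken as: the law of s_n X with X ~ φ_n, i.e. the density s_n^{-d} φ_n(·/s_n), converges weakly to φ; with φ_n(s_n ·) read literally (even normalized) the claim is ill-defined or fails. *)

theory Defs
  imports "HOL-Probability.Probability"
begin

definition is_density :: "('a::euclidean_space \<Rightarrow> real) \<Rightarrow> bool" where
  "is_density f \<longleftrightarrow> f \<in> borel_measurable lborel \<and> (\<forall>x. 0 \<le> f x)
     \<and> (\<integral>\<^sup>+x. ennreal (f x) \<partial>lborel) = 1"

definition density_measure :: "('a::euclidean_space \<Rightarrow> real) \<Rightarrow> 'a measure" where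
  "density_measure f = density lborel (\<lambda>x. ennreal (f x))"

definition log_concave :: "('a::euclidean_space \<Rightarrow> real) \<Rightarrow> bool" where
  "log_concave f \<longleftrightarrow> (\<forall>x y. \<forall>t\<in>{0..1::real}.
      f ((1 - t) *\<^sub>R x + t *\<^sub>R y) \<ge> f x powr (1 - t) * f y powr t)"

definition conv_in_distribution :: "(nat \<Rightarrow> 'a::euclidean_space measure) \<Rightarrow> 'a measure \<Rightarrow> bool" where
  "conv_in_distribution \<mu>s \<mu> \<longleftrightarrow>
     (\<forall>f::'a \<Rightarrow> real. continuous_on UNIV f \<and> bounded (range f) \<longrightarrow>
        (\<lambda>n. \<integral>x. f x \<partial>(\<mu>s n)) \<longlonglongrightarrow> (\<integral>x. f x \<partial>\<mu>))"

definition symmetric_kernel :: "('a::euclidean_space \<Rightarrow> 'a measure) \<Rightarrow> bool" where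
  "symmetric_kernel L \<longleftrightarrow> (\<forall>A\<in>sets borel. \<forall>B\<in>sets borel.
     (\<integral>\<^sup>+x. indicator A x * emeasure (L x) B \<partial>lborel)
       = (\<integral>\<^sup>+y. indicator B y * emeasure (L y) A \<partial>lborel))"

text \<open>Metropolis-Hastings acceptance probability \<open>min(1, g(y)/g(x))\<close>
  (with the usual convention that it equals 1 when \<open>g(x) = 0\<close>).\<close>
definition mh_accept :: "('a \<Rightarrow> real) \<Rightarrow> 'a \<Rightarrow> 'a \<Rightarrow> real" where
  "mh_accept g x y = (if g x > 0 then min 1 (g y / g x) else 1)"

definition mh_kernel :: "('a::euclidean_space \<Rightarrow> 'a measure) \<Rightarrow> ('a \<Rightarrow> real) \<Rightarrow> 'a \<Rightarrow> 'a measure" where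
  "mh_kernel Q g x = measure_of UNIV (sets borel)
     (\<lambda>A. \<integral>\<^sup>+y. ennreal (mh_accept g x y) * indicator A y
               + ennreal (1 - mh_accept g x y) * indicator A x \<partial>(Q x))"

text \<open>Rescaled proposal \<open>L_s(x,A) = L(s x, s A)\<close>.\<close>
definition scaled_kernel :: "('a::euclidean_space \<Rightarrow> 'a measure) \<Rightarrow> real \<Rightarrow> 'a \<Rightarrow> 'a measure" where
  "scaled_kernel L s x = distr (L (s *\<^sub>R x)) borel (\<lambda>y. (1 / s) *\<^sub>R y)"

abbreviation path_space :: "nat \<Rightarrow> (nat \<Rightarrow> 'a::euclidean_space) measure" where
  "path_space T \<equiv> PiM {..T} (\<lambda>_. borel)"

primrec path_law :: "('a::euclidean_space \<Rightarrow> 'a measure) \<Rightarrow> 'a \<Rightarrow> nat \<Rightarrow> (nat \<Rightarrow> 'a) measure" where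
  "path_law K x 0 = return (path_space 0) (\<lambda>i\<in>{..0}. x)"
| "path_law K x (Suc T) = bind (path_law K x T)
     (\<lambda>\<omega>. distr (K (\<omega> T)) (path_space (Suc T))
              (\<lambda>y. \<lambda>i\<in>{..Suc T}. if i = Suc T then y else \<omega> i))"

end

theory Submission
  imports Defs
begin

text \<open>
  Positivity on compact sets makes \<open>\<phi>\<close> positive and continuous everywhere. After rescaling,
  \<open>s\<^sub>n X\<close> is the Metropolis-Hastings chain with the fixed proposal \<open>L\<close> and target
  \<open>G\<^sub>n(y) = s\<^sub>n\<^sup>-\<^sup>d \<phi>\<^sub>n(y / s\<^sub>n)\<close>, a log-concave density, and \<open>G\<^sub>n \<rightarrow> \<phi>\<close> weakly. Log-concavity upgrades
  this to pointwise convergence. Lower bound: testing against bumps finds, near each vertex of a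
  small cross-polytope centred at \<open>z\<close>, a point where \<open>G\<^sub>n\<close> exceeds any given \<open>c < \<phi> z\<close>; the
  superlevel set is convex, hence contains a ball around \<open>z\<close>. Upper bound: if \<open>G\<^sub>n z \<ge> b > \<phi> z\<close>,
  log-concavity along segments from \<open>z\<close> into that ball makes \<open>G\<^sub>n\<close> exceed \<open>\<phi>\<close> by a fixed amount on
  a smaller ball, contradicting weak convergence. So acceptance probabilities converge pointwise,
  and by dominated convergence one step of the chain converges in total variation from every
  starting point. The path laws follow by induction on \<open>T\<close>, comparing integrals of test functions
  that may themselves vary with \<open>n\<close>, since the induction step integrates against the \<open>n\<close>-th kernel.
\<close>

subsection \<open>Log-concave densities and weak convergence\<close>

lemma log_concaveD:
  assumes "log_concave f" "t \<in> {0..1}"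
  shows "f x powr (1 - t) * f y powr t \<le> f ((1 - t) *\<^sub>R x + t *\<^sub>R y)"
  using assms unfolding log_concave_def by blast

text \<open>Lower bounds \<open>a\<close> and \<open>b\<close> stand in for the values of
  \<open>f\<close>, because later only bounds at the two endpoints are known. Positivity keeps
  \<open>powr\<close> monotone in its base.\<close>

lemma log_concave_ge:
  assumes lc: "log_concave f" and t: "t \<in> {0..1}" and pos: "0 < a" "0 < b"
    and ge: "a \<le> f x" "b \<le> f y"
  shows "a powr (1 - t) * b powr t \<le> f ((1 - t) *\<^sub>R x + t *\<^sub>R y)"
proof -
  have "a powr (1 - t) * b powr t \<le> f x powr (1 - t) * f y powr t"
    using t pos ge by (intro mult_mono powr_mono2) auto
  also have "\<dots> \<le> f ((1 - t) *\<^sub>R x + t *\<^sub>R y)"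
    by (rule log_concaveD[OF lc t])
  finally show ?thesis .
qed

lemma convex_superlevel_log_concave:
  assumes lc: "log_concave f" and c: "0 < c"
  shows "convex {y. c \<le> f y}"
  unfolding convex_alt
proof (intro ballI allI impI, clarify)
  fix x y and u :: real assume *: "c \<le> f x" "c \<le> f y" "0 \<le> u" "u \<le> 1"
  have "c = c powr (1 - u) * c powr u"
    using c by (simp flip: powr_add)
  also have "\<dots> \<le> f ((1 - u) *\<^sub>R x + u *\<^sub>R y)"
    using * c by (intro log_concave_ge[OF lc]) auto
  finally show "c \<le> f ((1 - u) *\<^sub>R x + u *\<^sub>R y)" .
qed

lemma log_concave_scale:
  assumes lc: "log_concave f" and nn: "\<And>x. 0 \<le> f x" and c: "0 < c"
  shows "log_concave (\<lambda>y. c * f (k *\<^sub>R y))"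
  unfolding log_concave_def
proof (intro allI ballI)
  fix x y :: 'a and t :: real assume t: "t \<in> {0..1}"
  have "(c * f (k *\<^sub>R x)) powr (1 - t) * (c * f (k *\<^sub>R y)) powr t
     = (c powr (1 - t) * c powr t) * (f (k *\<^sub>R x) powr (1 - t) * f (k *\<^sub>R y) powr t)"
    using nn c by (simp add: powr_mult)
  also have "c powr (1 - t) * c powr t = c"
    using c by (simp flip: powr_add)
  also have "c * (f (k *\<^sub>R x) powr (1 - t) * f (k *\<^sub>R y) powr t)
      \<le> c * f ((1 - t) *\<^sub>R (k *\<^sub>R x) + t *\<^sub>R (k *\<^sub>R y))"
    using c by (intro mult_left_mono log_concaveD[OF lc t]) auto
  also have "(1 - t) *\<^sub>R (k *\<^sub>R x) + t *\<^sub>R (k *\<^sub>R y) = k *\<^sub>R ((1 - t) *\<^sub>R x + t *\<^sub>R y)"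
    by (simp add: algebra_simps)
  finally show "(c * f (k *\<^sub>R x)) powr (1 - t) * (c * f (k *\<^sub>R y)) powr t
      \<le> c * f (k *\<^sub>R ((1 - t) *\<^sub>R x + t *\<^sub>R y))" .
qed

section \<open>From weak to pointwise convergence\<close>

text \<open>A point \<open>w\<close> of the ball outside \<open>C\<close> is separated from
  \<open>C\<close> by a hyperplane through \<open>w\<close> with some normal \<open>a\<close>. One
  vertex of the cross-polytope lies so far on the wrong side that every point within
  \<open>\<delta>\<close> of it does too, yet \<open>C\<close> contains such a point.\<close>

lemma ball_subset_convex_if_meets_cross_polytope_balls:
  fixes C :: "'a::euclidean_space set"
  assumes "convex C" and r: "0 < r" and \<delta>: "\<delta> = r / (2 * DIM('a))"
    and meets: "\<And>b \<sigma>. b \<in> Basis \<Longrightarrow> \<sigma> \<in> {-1, 1} \<Longrightarrow> \<exists>y\<in>ball (z + (\<sigma> * r) *\<^sub>R b) \<delta>. y \<in> C"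
  shows "ball z \<delta> \<subseteq> C"
proof
  fix w assume w: "w \<in> ball z \<delta>"
  show "w \<in> C"
  proof (rule ccontr)
    assume "w \<notin> C"
    then have "0 \<notin> (\<lambda>y. y - w) ` C" by auto
    moreover have "convex ((\<lambda>y. y - w) ` C)"
      using convex_translation_subtract[OF \<open>convex C\<close>, of w] by simp
    ultimately obtain a where a: "a \<noteq> 0" "\<And>y. y \<in> C \<Longrightarrow> 0 \<le> a \<bullet> (y - w)"
      using separating_hyperplane_set_0[of "(\<lambda>y. y - w) ` C"] by auto
    \<comment> \<open>The norm of \<open>a\<close> is at most the sum of its absolute coordinates,
      so the largest of them is at least the average. This is where the dimension enters
      \<open>\<delta>\<close>.\<close>
    have "\<exists>b\<in>Basis. norm a / DIM('a) \<le> \<bar>a \<bullet> b\<bar>"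
    proof (rule ccontr)
      assume "\<not> ?thesis"
      then have "(\<Sum>b\<in>Basis. \<bar>a \<bullet> b\<bar>) < (\<Sum>b\<in>(Basis::'a set). norm a / DIM('a))"
        by (intro sum_strict_mono) auto
      with norm_le_l1[of a] show False by simp
    qed
    then obtain b where b: "b \<in> Basis" "norm a / DIM('a) \<le> \<bar>a \<bullet> b\<bar>" by blast
    \<comment> \<open>The sign selects the vertex on the negative side of the hyperplane.\<close>
    define \<sigma> :: real where "\<sigma> = (if 0 \<le> a \<bullet> b then -1 else 1)"
    have \<sigma>: "\<sigma> \<in> {-1, 1}" "\<sigma> * (a \<bullet> b) = - \<bar>a \<bullet> b\<bar>" by (auto simp: \<sigma>_def)
    obtain y where y: "y \<in> ball (z + (\<sigma> * r) *\<^sub>R b) \<delta>" "y \<in> C"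
      using meets[OF b(1) \<sigma>(1)] by blast
    have "a \<bullet> (y - w) = a \<bullet> (y - (z + (\<sigma> * r) *\<^sub>R b)) + a \<bullet> (z - w) + r * (\<sigma> * (a \<bullet> b))"
      by (simp add: inner_diff_right inner_add_right)
    also have "a \<bullet> (y - (z + (\<sigma> * r) *\<^sub>R b)) \<le> norm a * norm (y - (z + (\<sigma> * r) *\<^sub>R b))"
      by (rule norm_cauchy_schwarz)
    also have "\<dots> < norm a * \<delta>"
      using y(1) a(1) by (intro mult_strict_left_mono) (auto simp: dist_norm norm_minus_commute)
    also have "a \<bullet> (z - w) \<le> norm a * norm (z - w)"
      by (rule norm_cauchy_schwarz)
    also have "\<dots> \<le> norm a * \<delta>"
      using w by (intro mult_left_mono) (auto simp: dist_norm)
    also have "r * (\<sigma> * (a \<bullet> b)) \<le> - r * (norm a / DIM('a))"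
      using mult_left_mono[OF b(2), of r] r unfolding \<sigma>(2) by simp
    \<comment> \<open>The value of \<open>\<delta>\<close> makes the three bounds cancel exactly.
      Strictness comes from \<open>y\<close> lying in the open ball around the vertex.\<close>
    also have "norm a * \<delta> + norm a * \<delta> + - r * (norm a / DIM('a)) = 0"
      by (simp add: \<delta>)
    finally show False using a(2)[OF y(2)] by simp
  qed
qed

text \<open>The test function is a tent \<open>f\<close> supported in the ball. If
  \<open>g n\<close> stayed at or below \<open>c\<close> there, the integral of
  \<open>f * g n\<close> would be at most \<open>c\<close> times that of \<open>f\<close>, strictly
  less than the limit. No sign is assumed for \<open>g\<close>, \<open>\<phi>\<close> or
  \<open>c\<close>, so negated functions turn this into an upper estimate.\<close>

lemma weak_convergence_eventually_exceeds:
  fixes g :: "nat \<Rightarrow> 'a::euclidean_space \<Rightarrow> real"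
  assumes conv: "\<And>f::'a \<Rightarrow> real. continuous_on UNIV f \<Longrightarrow> bounded (range f) \<Longrightarrow>
      (\<lambda>n. \<integral>x. f x * g n x \<partial>lborel) \<longlonglongrightarrow> (\<integral>x. f x * \<phi> x \<partial>lborel)"
    and g: "\<And>n. integrable lborel (g n)" and \<phi>: "integrable lborel \<phi>"
    and \<rho>: "0 < \<rho>" and c: "c < c'" and le: "\<And>y. y \<in> ball v \<rho> \<Longrightarrow> c' \<le> \<phi> y"
  shows "\<forall>\<^sub>F n in sequentially. \<exists>y\<in>ball v \<rho>. c < g n y"
proof -
  define f where "f y = max 0 (\<rho> - dist v y)" for y
  have cf: "continuous_on UNIV f"
    unfolding f_def by (intro continuous_intros)
  have f0: "0 \<le> f y" and f1: "f y \<le> \<rho>" for y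
    using \<rho> by (auto simp: f_def)
  have fout: "f y = 0" if "y \<notin> ball v \<rho>" for y
    using that by (auto simp: f_def)
  have bf: "bounded (range f)"
    using f0 f1 by (intro boundedI[of _ \<rho>]) auto
  have [measurable]: "f \<in> borel_measurable borel"
    using cf by (rule borel_measurable_continuous_onI)
  have "integrable lborel (\<lambda>x. indicator (cball v \<rho>) x *\<^sub>R f x)"
    by (intro borel_integrable_compact continuous_on_subset[OF cf]) auto
  also have "(\<lambda>x. indicator (cball v \<rho>) x *\<^sub>R f x) = f"
    using fout by (auto simp: indicator_def fun_eq_iff)
  finally have intf: "integrable lborel f" .
  have intfh: "integrable lborel (\<lambda>x. f x * h x)" if h: "integrable lborel h" for h :: "'a \<Rightarrow> real"
  proof (rule Bochner_Integration.integrable_bound)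
    show "integrable lborel (\<lambda>x. \<rho> * h x)" using h by simp
    have [measurable]: "h \<in> borel_measurable borel" using borel_measurable_integrable[OF h] by simp
    show "(\<lambda>x. f x * h x) \<in> borel_measurable lborel" by measurable
    show "AE x in lborel. norm (f x * h x) \<le> norm (\<rho> * h x)"
      using f0 f1 \<rho> by (auto simp: abs_mult intro!: mult_right_mono)
  qed
  \<comment> \<open>The tent is at least \<open>\<rho> / 2\<close> on the ball of half the radius,
    so its integral is strictly positive. This preserves the gap between \<open>c\<close> and
    \<open>c'\<close> after integration.\<close>
  have "0 < \<rho> / 2 * measure lborel (ball v (\<rho> / 2))"
    using \<rho> content_ball_pos[of "\<rho> / 2" v] by (simp add: measure_completion)
  also have "\<dots> = (\<integral>x. \<rho> / 2 * indicator (ball v (\<rho> / 2)) x \<partial>lborel)"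
    by simp
  also have "\<dots> \<le> (\<integral>x. f x \<partial>lborel)"
  proof (rule integral_mono[OF _ intf])
    show "integrable lborel (\<lambda>x. \<rho> / 2 * indicator (ball v (\<rho> / 2)) x)"
      using emeasure_lborel_ball_finite[of v "\<rho> / 2"]
      by (intro integrable_mult_right integrable_real_indicator) (auto simp: top.not_eq_extremum)
    show "\<rho> / 2 * indicator (ball v (\<rho> / 2)) x \<le> f x" for x
      by (auto simp: f_def indicator_def max_def)
  qed
  finally have fpos: "0 < (\<integral>x. f x \<partial>lborel)" .
  have "c * (\<integral>x. f x \<partial>lborel) < c' * (\<integral>x. f x \<partial>lborel)"
    using fpos c by simp
  also have "\<dots> = (\<integral>x. f x * c' \<partial>lborel)" by simp
  also have "\<dots> \<le> (\<integral>x. f x * \<phi> x \<partial>lborel)"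
  proof (rule integral_mono[OF _ intfh[OF \<phi>]])
    show "integrable lborel (\<lambda>x. f x * c')" using intf by simp
    show "f x * c' \<le> f x * \<phi> x" for x
      using f0[of x] le[of x] fout[of x] by (cases "x \<in> ball v \<rho>") (auto intro: mult_left_mono)
  qed
  finally have "\<forall>\<^sub>F n in sequentially. c * (\<integral>x. f x \<partial>lborel) < (\<integral>x. f x * g n x \<partial>lborel)"
    using order_tendstoD(1)[OF conv[OF cf bf]] by blast
  then show ?thesis
  proof eventually_elim
    case (elim n)
    show ?case
    proof (rule ccontr)
      assume "\<not> ?thesis"
      then have "g n x \<le> c" if "x \<in> ball v \<rho>" for x
        using that by (simp add: not_less)
      then have "f x * g n x \<le> f x * c" for x
        using f0[of x] fout[of x] by (cases "x \<in> ball v \<rho>") (auto intro: mult_left_mono)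
      then have "(\<integral>x. f x * g n x \<partial>lborel) \<le> (\<integral>x. f x * c \<partial>lborel)"
        using intf by (intro integral_mono[OF intfh[OF g]]) auto
      with elim show False by (simp add: mult.commute)
    qed
  qed
qed

text \<open>Each vertex ball of a small cross-polytope eventually contains a point where
  \<open>g n\<close> exceeds \<open>c\<close>. Convexity of the superlevel set then fills a ball
  around \<open>z\<close> whose radius does not depend on \<open>n\<close>.\<close>

lemma log_concave_weak_convergence_locally_bounded_below:
  fixes g :: "nat \<Rightarrow> 'a::euclidean_space \<Rightarrow> real"
  assumes conv: "\<And>f::'a \<Rightarrow> real. continuous_on UNIV f \<Longrightarrow> bounded (range f) \<Longrightarrow>
      (\<lambda>n. \<integral>x. f x * g n x \<partial>lborel) \<longlonglongrightarrow> (\<integral>x. f x * \<phi> x \<partial>lborel)"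
    and g: "\<And>n. integrable lborel (g n)" and \<phi>: "integrable lborel \<phi>"
    and lc: "\<And>n. log_concave (g n)" and cont: "continuous_on UNIV \<phi>"
    and c: "0 < c" "c < \<phi> z"
  obtains \<delta> where "0 < \<delta>" "\<forall>\<^sub>F n in sequentially. ball z \<delta> \<subseteq> {y. c \<le> g n y}"
proof -
  define c' where "c' = (c + \<phi> z) / 2"
  have c': "c < c'" "c' < \<phi> z" using c by (auto simp: c'_def)
  have "open {y. c' < \<phi> y}"
    using cont by (intro open_Collect_less continuous_intros)
  then obtain \<rho> where \<rho>: "0 < \<rho>" "ball z \<rho> \<subseteq> {y. c' < \<phi> y}"
    using c' unfolding open_contains_ball by blast
  \<comment> \<open>Since \<open>\<delta> \<le> r\<close>, the balls of radius
    \<open>\<delta>\<close> around the vertices, at distance \<open>r\<close> from \<open>z\<close>,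
    remain inside \<open>ball z \<rho>\<close>, where \<phi> exceeds \<open>c'\<close>.\<close>
  define r where "r = \<rho> / 2"
  define \<delta> where "\<delta> = r / (2 * DIM('a))"
  have r: "0 < r" using \<rho> by (simp add: r_def)
  have \<delta>: "0 < \<delta>" using r by (simp add: \<delta>_def)
  have "Suc 0 \<le> DIM('a)" using DIM_positive[where 'a='a] by linarith
  then have "1 \<le> 2 * real DIM('a)" by linarith
  then have "r * 1 \<le> r * (2 * DIM('a))"
    using r by (intro mult_left_mono) linarith+
  then have "\<delta> \<le> r"
    unfolding \<delta>_def by (simp add: divide_le_eq)
  have "\<forall>\<^sub>F n in sequentially. \<forall>p\<in>Basis \<times> {-1, 1}.
      \<exists>y\<in>ball (z + (snd p * r) *\<^sub>R fst p) \<delta>. c < g n y"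
  \<comment> \<open>There are finitely many vertices, indexed by pairs of a basis vector and a sign,
    so one threshold for \<open>n\<close> serves all of them.\<close>
  proof (intro eventually_ball_finite ballI)
    fix p :: "'a \<times> real" assume p: "p \<in> Basis \<times> {-1, 1}"
    have "ball (z + (snd p * r) *\<^sub>R fst p) \<delta> \<subseteq> ball z \<rho>"
    proof
      fix y assume y: "y \<in> ball (z + (snd p * r) *\<^sub>R fst p) \<delta>"
      have "dist z (z + (snd p * r) *\<^sub>R fst p) = r"
        using p r by (auto simp: dist_norm)
      with y \<open>\<delta> \<le> r\<close> dist_triangle[of z y "z + (snd p * r) *\<^sub>R fst p"]
      show "y \<in> ball z \<rho>" by (simp add: r_def)
    qed
    then have "c' \<le> \<phi> y" if "y \<in> ball (z + (snd p * r) *\<^sub>R fst p) \<delta>" for y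
      using subsetD[OF \<rho>(2), of y] that by auto
    then show "\<forall>\<^sub>F n in sequentially. \<exists>y\<in>ball (z + (snd p * r) *\<^sub>R fst p) \<delta>. c < g n y"
      using c'(1) by (intro weak_convergence_eventually_exceeds[OF conv g \<phi> \<delta>])
  qed auto
  then have "\<forall>\<^sub>F n in sequentially. ball z \<delta> \<subseteq> {y. c \<le> g n y}"
  proof eventually_elim
    case (elim n)
    show ?case
    proof (rule ball_subset_convex_if_meets_cross_polytope_balls[OF _ r \<delta>_def])
      show "convex {y. c \<le> g n y}" by (rule convex_superlevel_log_concave[OF lc c(1)])
      show "\<exists>y\<in>ball (z + (\<sigma> * r) *\<^sub>R b) \<delta>. y \<in> {y. c \<le> g n y}" if "b \<in> Basis" "\<sigma> \<in> {-1, 1}" for b \<sigma>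
        using elim that by (fastforce intro: less_imp_le)
    qed
  qed
  with \<delta> show ?thesis by (rule that)
qed

text \<open>The local lower bound gives one half at once. For the other half, a value of
  \<open>g n\<close> at \<open>z\<close> that is too large would, by interpolation with the uniform
  lower bound on a ball, keep \<open>g n\<close> too large on a whole smaller ball, which weak
  convergence forbids.\<close>

lemma log_concave_weak_convergence_pointwise:
  fixes g :: "nat \<Rightarrow> 'a::euclidean_space \<Rightarrow> real"
  assumes conv: "\<And>f::'a \<Rightarrow> real. continuous_on UNIV f \<Longrightarrow> bounded (range f) \<Longrightarrow>
      (\<lambda>n. \<integral>x. f x * g n x \<partial>lborel) \<longlonglongrightarrow> (\<integral>x. f x * \<phi> x \<partial>lborel)"
    and g: "\<And>n. integrable lborel (g n)" and \<phi>: "integrable lborel \<phi>"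
    and lc: "\<And>n. log_concave (g n)" and cont: "continuous_on UNIV \<phi>"
    and pos: "0 < \<phi> z"
  shows "(\<lambda>n. g n z) \<longlonglongrightarrow> \<phi> z"
proof (rule order_tendstoI)
  fix a assume a: "a < \<phi> z"
  \<comment> \<open>The given \<open>a\<close> may be negative, while the superlevel argument needs
    a positive level.\<close>
  define c where "c = (max a 0 + \<phi> z) / 2"
  have c: "0 < c" "a < c" "c < \<phi> z" using a pos by (auto simp: c_def max_def)
  obtain \<delta> where "0 < \<delta>" "\<forall>\<^sub>F n in sequentially. ball z \<delta> \<subseteq> {y. c \<le> g n y}"
    by (rule log_concave_weak_convergence_locally_bounded_below[OF conv g \<phi> lc cont c(1,3)])
  then show "\<forall>\<^sub>F n in sequentially. a < g n z"
    using c(2) by (elim eventually_mono) (auto dest!: subsetD[where c=z])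
next
  fix b assume b: "\<phi> z < b"
  \<comment> \<open>Two thresholds are placed between \<open>\<phi> z\<close> and \<open>b\<close>.
    The gap from \<open>k'\<close> to \<open>k\<close> feeds the weak convergence argument, and the
    gap from \<open>k\<close> to \<open>b\<close> absorbs the loss in the interpolation.\<close>
  define k where "k = (\<phi> z + b) / 2"
  define k' where "k' = (\<phi> z + k) / 2"
  have k: "\<phi> z < k'" "k' < k" "k < b" using b by (auto simp: k_def k'_def)
  have b0: "0 < b" using b pos by simp
  define c where "c = \<phi> z / 2"
  have c: "0 < c" "c < \<phi> z" using pos by (auto simp: c_def)
  obtain \<delta> where \<delta>: "0 < \<delta>" "\<forall>\<^sub>F n in sequentially. ball z \<delta> \<subseteq> {y. c \<le> g n y}"
    by (rule log_concave_weak_convergence_locally_bounded_below[OF conv g \<phi> lc cont c])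
  \<comment> \<open>The interpolated bound tends to \<open>b\<close> as \<open>t\<close> decreases
    to 0, so some \<open>t\<close> strictly between 0 and 1, chosen independently of
    \<open>n\<close>, keeps it above \<open>k\<close>.\<close>
  have "((\<lambda>t. b powr (1 - t) * c powr t) \<longlongrightarrow> b powr (1 - 0) * c powr 0) (at_right 0)"
    using b0 c by (intro tendsto_intros) auto
  then have "\<forall>\<^sub>F t in at_right 0. k < b powr (1 - t) * c powr t"
    using b0 c k by (intro order_tendstoD(1)) auto
  moreover have "\<forall>\<^sub>F t in at_right 0. t \<in> {0<..<1::real}"
    by (rule eventually_at_right_real) simp
  ultimately have "\<forall>\<^sub>F t in at_right 0. k < b powr (1 - t) * c powr t \<and> t \<in> {0<..<1}"
    by eventually_elim auto
  from eventually_happens'[OF _ this] obtain t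
    where t: "k < b powr (1 - t) * c powr t" "0 < t" "t < 1" by auto
  have "open {y. \<phi> y < k'}"
    using cont by (intro open_Collect_less continuous_intros)
  then obtain \<rho> where \<rho>: "0 < \<rho>" "ball z \<rho> \<subseteq> {y. \<phi> y < k'}"
    using k unfolding open_contains_ball by blast
  \<comment> \<open>The factor \<open>t\<close> ensures that stretching a point of
    \<open>ball z \<eta>\<close> away from \<open>z\<close> by \<open>1 / t\<close> stays within
    \<open>ball z \<delta>\<close>.\<close>
  define \<eta> where "\<eta> = t * min \<delta> \<rho>"
  have \<eta>: "0 < \<eta>" using t \<delta> \<rho> by (simp add: \<eta>_def)
  have "\<eta> \<le> 1 * \<rho>" unfolding \<eta>_def using t \<delta> \<rho> by (intro mult_mono) auto
  then have sub: "ball z \<eta> \<subseteq> ball z \<rho>" by (intro subset_ball) simp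
  have "\<forall>\<^sub>F n in sequentially. \<exists>y\<in>ball z \<eta>. - k < - g n y"
  \<comment> \<open>Negating both functions yields a point near \<open>z\<close> where
    \<open>g n\<close> is below \<open>k\<close>.\<close>
  proof (rule weak_convergence_eventually_exceeds[where \<phi> = "\<lambda>y. - \<phi> y" and c' = "- k'"])
    show "(\<lambda>n. \<integral>x. f x * - g n x \<partial>lborel) \<longlonglongrightarrow> (\<integral>x. f x * - \<phi> x \<partial>lborel)"
      if "continuous_on UNIV f" "bounded (range f)" for f :: "'a \<Rightarrow> real"
      using tendsto_minus[OF conv[OF that]] by simp
    show "- k' \<le> - \<phi> y" if "y \<in> ball z \<eta>" for y
      using subsetD[OF \<rho>(2) subsetD[OF sub that]] by simp
  qed (use g \<phi> k \<eta> in auto)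
  with \<delta>(2) show "\<forall>\<^sub>F n in sequentially. g n z < b"
  proof eventually_elim
    case (elim n)
    then obtain y where y: "y \<in> ball z \<eta>" "g n y < k" by auto
    \<comment> \<open>The segment from \<open>z\<close> through \<open>y\<close> is prolonged to
      \<open>w\<close>, so that \<open>y\<close> divides it in the ratio prescribed by
      \<open>t\<close>.\<close>
    define w where "w = z + (1 / t) *\<^sub>R (y - z)"
    have yw: "y = (1 - t) *\<^sub>R z + t *\<^sub>R w"
      using t by (simp add: w_def algebra_simps)
    have "dist z y < t * \<delta>"
      using y(1) t by (auto simp: \<eta>_def intro: less_le_trans mult_left_mono)
    moreover have "dist z w = dist z y / t"
      using t by (simp add: w_def dist_norm norm_minus_commute)
    ultimately have "w \<in> ball z \<delta>"
      using t by (simp add: divide_less_eq mult.commute)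
    then have "c \<le> g n w" using elim by auto
    show ?case
    proof (rule ccontr)
      assume "\<not> g n z < b"
      then have "b powr (1 - t) * c powr t \<le> g n y"
        unfolding yw using t b0 c \<open>c \<le> g n w\<close> by (intro log_concave_ge[OF lc]) auto
      with y(2) t(1) show False by simp
    qed
  qed
qed

section \<open>Densities under dilation\<close>

text \<open>The function \<open>g\<close> is the density of \<open>s\<close> times a variable with
  density \<open>f\<close>. Both claims follow by writing \<open>lborel\<close> as
  \<open>s ^ DIM('a)\<close> times its own image under the dilation, which cancels the factor in
  \<open>g\<close>.\<close>

lemma
  fixes f :: "'a::euclidean_space \<Rightarrow> real"
  assumes "is_density f" and s: "0 < s"
  defines "g \<equiv> \<lambda>y. (1 / s ^ DIM('a)) * f ((1 / s) *\<^sub>R y)"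
  shows integrable_scaled_density: "integrable lborel g"
    and integral_distr_scaled_density: "F \<in> borel_measurable borel \<Longrightarrow>
      (\<integral>x. F x \<partial>distr (density_measure f) borel (\<lambda>z. s *\<^sub>R z)) = (\<integral>x. F x * g x \<partial>lborel)"
proof -
  have [measurable]: "f \<in> borel_measurable borel" and f0: "\<And>x. 0 \<le> f x"
    and f1: "(\<integral>\<^sup>+x. ennreal (f x) \<partial>lborel) = 1"
    using assms by (auto simp: is_density_def)
  have [measurable]: "g \<in> borel_measurable borel" unfolding g_def by measurable
  have lb: "lborel = density (distr lborel borel (\<lambda>x::'a. s *\<^sub>R x)) (\<lambda>_. ennreal (s ^ DIM('a)))"
    using lborel_affine[of s "0::'a"] s by (simp add: ennreal_power)
  have intf: "integrable lborel f"
    using f0 f1 by (intro integrableI_nonneg) auto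
  have "integrable (density (distr lborel borel (\<lambda>x::'a. s *\<^sub>R x)) (\<lambda>_. ennreal (s ^ DIM('a)))) g"
    using s intf by (subst integrable_density) (auto simp: integrable_distr_eq g_def)
  then show "integrable lborel g" by (subst lb)
  assume [measurable]: "F \<in> borel_measurable borel"
  have "(\<integral>x. F x * g x \<partial>lborel)
      = (\<integral>x. F x * g x \<partial>density (distr lborel borel (\<lambda>x::'a. s *\<^sub>R x)) (\<lambda>_. ennreal (s ^ DIM('a))))"
    by (subst lb) simp
  also have "\<dots> = (\<integral>x. f x * F (s *\<^sub>R x) \<partial>lborel)"
    using s by (subst integral_density) (auto simp: integral_distr g_def mult.commute)
  also have "\<dots> = (\<integral>x. F x \<partial>distr (density_measure f) borel (\<lambda>z. s *\<^sub>R z))"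
    using f0 unfolding density_measure_def by (simp add: integral_distr integral_density)
  finally show "(\<integral>x. F x \<partial>distr (density_measure f) borel (\<lambda>z. s *\<^sub>R z)) = (\<integral>x. F x * g x \<partial>lborel)" ..
qed

subsection \<open>Metropolis-Hastings kernels\<close>

lemma mh_accept_nonneg: "(\<And>x. 0 \<le> g x) \<Longrightarrow> 0 \<le> mh_accept g x y"
  and mh_accept_le_1: "mh_accept g x y \<le> 1"
  by (auto simp: mh_accept_def)

lemma measurable_mh_accept [measurable (raw)]:
  assumes [measurable]: "g \<in> borel_measurable borel" "u \<in> M \<rightarrow>\<^sub>M borel" "v \<in> M \<rightarrow>\<^sub>M borel"
  shows "(\<lambda>w. mh_accept g (u w) (v w)) \<in> borel_measurable M"
  unfolding mh_accept_def by measurable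

lemma sets_mh_kernel [simp, measurable_cong]: "sets (mh_kernel Q g x) = sets borel"
  and space_mh_kernel [simp]: "space (mh_kernel Q g x) = UNIV"
  unfolding mh_kernel_def by (auto simp: sets.sigma_sets_eq[of borel, simplified] space_measure_of_conv)

text \<open>The kernel is defined by \<open>measure_of\<close>, which takes the prescribed values
  only once the set function is known to be countably additive.\<close>

lemma emeasure_mh_kernel:
  assumes Q[measurable_cong]: "sets (Q x) = sets borel" and g[measurable]: "g \<in> borel_measurable borel"
    and A: "A \<in> sets borel"
  shows "emeasure (mh_kernel Q g x) A = (\<integral>\<^sup>+y. ennreal (mh_accept g x y) * indicator A y
               + ennreal (1 - mh_accept g x y) * indicator A x \<partial>(Q x))"
proof (rule emeasure_measure_of[OF mh_kernel_def])
  show "countably_additive (sets (mh_kernel Q g x)) (\<lambda>A. \<integral>\<^sup>+y. ennreal (mh_accept g x y) * indicator A y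
               + ennreal (1 - mh_accept g x y) * indicator A x \<partial>(Q x))"
  proof (rule countably_additiveI)
    fix A :: "nat \<Rightarrow> _ set"
    assume A: "range A \<subseteq> sets (mh_kernel Q g x)" "disjoint_family A"
    then have [measurable]: "A i \<in> sets borel" for i by auto
    show "(\<Sum>i. \<integral>\<^sup>+y. ennreal (mh_accept g x y) * indicator (A i) y
               + ennreal (1 - mh_accept g x y) * indicator (A i) x \<partial>(Q x))
      = (\<integral>\<^sup>+y. ennreal (mh_accept g x y) * indicator (\<Union>i. A i) y
               + ennreal (1 - mh_accept g x y) * indicator (\<Union>i. A i) x \<partial>(Q x))"
      by (subst nn_integral_suminf[symmetric])
         (auto intro!: nn_integral_cong simp: suminf_add[symmetric] suminf_indicator[OF A(2), symmetric])
  qed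
qed (use A in \<open>auto simp: positive_def\<close>)

text \<open>Indicators are the previous formula, and the right-hand side is additive, homogeneous
  and continuous along increasing sequences in \<open>h\<close>, including its value at the fixed
  point \<open>x\<close>.\<close>

lemma nn_integral_mh_kernel:
  assumes Q[measurable_cong]: "sets (Q x) = sets borel" and g[measurable]: "g \<in> borel_measurable borel"
    and h: "h \<in> borel_measurable borel"
  shows "(\<integral>\<^sup>+y. h y \<partial>mh_kernel Q g x) = (\<integral>\<^sup>+y. ennreal (mh_accept g x y) * h y
               + ennreal (1 - mh_accept g x y) * h x \<partial>(Q x))"
  using h
proof (induction rule: borel_measurable_induct)
  case (cong f g)
  then show ?case by simp
next
  case (set A)
  then show ?case using emeasure_mh_kernel[of Q x g A, OF Q g] by simp
next
  case (mult u c)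
  note [measurable] = mult(2)
  have "(\<integral>\<^sup>+y. c * u y \<partial>mh_kernel Q g x) = c * (\<integral>\<^sup>+y. ennreal (mh_accept g x y) * u y
               + ennreal (1 - mh_accept g x y) * u x \<partial>(Q x))"
    using mult by (subst nn_integral_cmult) auto
  also have "\<dots> = (\<integral>\<^sup>+y. c * (ennreal (mh_accept g x y) * u y
               + ennreal (1 - mh_accept g x y) * u x) \<partial>(Q x))"
    by (rule nn_integral_cmult[symmetric]) measurable
  finally show ?case by (simp add: distrib_left mult_ac)
next
  case (add u v)
  note [measurable] = add(1,3)
  have "(\<integral>\<^sup>+y. v y + u y \<partial>mh_kernel Q g x) =
     (\<integral>\<^sup>+y. ennreal (mh_accept g x y) * v y + ennreal (1 - mh_accept g x y) * v x \<partial>(Q x)) +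
     (\<integral>\<^sup>+y. ennreal (mh_accept g x y) * u y + ennreal (1 - mh_accept g x y) * u x \<partial>(Q x))"
    using add by (subst nn_integral_add) auto
  also have "\<dots> = (\<integral>\<^sup>+y. (ennreal (mh_accept g x y) * v y + ennreal (1 - mh_accept g x y) * v x) +
      (ennreal (mh_accept g x y) * u y + ennreal (1 - mh_accept g x y) * u x) \<partial>(Q x))"
    by (rule nn_integral_add[symmetric]) measurable
  finally show ?case by (simp add: distrib_left add_ac)
next
  case (seq U)
  note [measurable] = seq(1)
  have mono: "incseq (\<lambda>i. U i y)" for y
    using seq(3) by (auto simp: incseq_def le_fun_def)
  have "(\<integral>\<^sup>+y. (SUP i. U i y) \<partial>mh_kernel Q g x) = (SUP i. \<integral>\<^sup>+y. U i y \<partial>mh_kernel Q g x)"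
    using seq(3) by (intro nn_integral_monotone_convergence_SUP) auto
  also have "\<dots> = (SUP i. (\<integral>\<^sup>+y. ennreal (mh_accept g x y) * U i y
               + ennreal (1 - mh_accept g x y) * U i x \<partial>(Q x)))"
    using seq.IH by simp
  also have "\<dots> = (\<integral>\<^sup>+y. (SUP i. ennreal (mh_accept g x y) * U i y
               + ennreal (1 - mh_accept g x y) * U i x) \<partial>(Q x))"
    using mono by (intro nn_integral_monotone_convergence_SUP[symmetric])
      (auto simp: incseq_def le_fun_def intro!: add_mono mult_left_mono)
  also have "\<dots> = (\<integral>\<^sup>+y. ennreal (mh_accept g x y) * (SUP i. U i y)
               + ennreal (1 - mh_accept g x y) * (SUP i. U i x) \<partial>(Q x))"
    using mono by (intro nn_integral_cong, subst ennreal_SUP_add)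
      (auto simp: incseq_def SUP_mult_left_ennreal intro!: mult_left_mono)
  finally show ?case by (simp add: image_comp)
qed

lemma prob_algebra_kernelD:
  assumes "K \<in> M \<rightarrow>\<^sub>M prob_algebra N" "x \<in> space M"
  shows "prob_space (K x)" "sets (K x) = sets N"
  using measurable_space[OF assms] by (auto simp: space_prob_algebra)

text \<open>The mass is one because acceptance and rejection probabilities add up to one under the
  proposal. Measurability in the starting point is inherited from \<open>Q\<close> through the
  integral formula.\<close>

lemma measurable_mh_kernel:
  assumes Q: "Q \<in> borel \<rightarrow>\<^sub>M prob_algebra borel" and g[measurable]: "g \<in> borel_measurable borel"
    and g0: "\<And>x. 0 \<le> g x"
  shows "mh_kernel Q g \<in> borel \<rightarrow>\<^sub>M prob_algebra borel"
proof (rule measurable_prob_algebra_generated[where \<Omega> = UNIV and G = "sets borel"])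
  note setsQ[measurable_cong] = prob_algebra_kernelD(2)[OF Q, simplified]
  note em = emeasure_mh_kernel[of Q _ g, OF setsQ g]
  show "sets borel = sigma_sets UNIV (sets borel)"
    using sets.sigma_sets_eq[of borel] by (metis space_borel)
  show "prob_space (mh_kernel Q g a)" for a
  proof
    interpret prob_space "Q a" using prob_algebra_kernelD(1)[OF Q] by simp
    have "emeasure (mh_kernel Q g a) UNIV = (\<integral>\<^sup>+y. 1 \<partial>Q a)"
      unfolding em[OF space_in_borel]
      by (intro nn_integral_cong) (simp add: mh_accept_nonneg[of g, OF g0] mh_accept_le_1 flip: ennreal_plus)
    then show "emeasure (mh_kernel Q g a) (space (mh_kernel Q g a)) = 1"
      by (simp add: emeasure_space_1)
  qed
  show "(\<lambda>a. emeasure (mh_kernel Q g a) A) \<in> borel_measurable borel" if [measurable]: "A \<in> sets borel" for A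
    unfolding em[OF that]
    by (rule nn_integral_measurable_subprob_algebra2[OF _ measurable_prob_algebraD[OF Q]]) measurable
qed (auto simp: Int_stable_def)

lemma integral_mh_kernel:
  assumes Q: "Q \<in> borel \<rightarrow>\<^sub>M prob_algebra borel" and g[measurable]: "g \<in> borel_measurable borel"
    and g0: "\<And>x. 0 \<le> g x"
    and h[measurable]: "h \<in> borel_measurable borel" and h01: "\<And>y. h y \<in> {0..1}"
  shows "(\<integral>y. h y \<partial>mh_kernel Q g x) = (\<integral>y. mh_accept g x y * h y + (1 - mh_accept g x y) * h x \<partial>Q x)"
proof -
  note setsQ[measurable_cong] = prob_algebra_kernelD(2)[OF Q, simplified]
  have "(\<integral>y. h y \<partial>mh_kernel Q g x) = enn2real (\<integral>\<^sup>+y. ennreal (h y) \<partial>mh_kernel Q g x)"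
    using h01 by (intro integral_eq_nn_integral) auto
  also have "(\<integral>\<^sup>+y. ennreal (h y) \<partial>mh_kernel Q g x) =
     (\<integral>\<^sup>+y. ennreal (mh_accept g x y * h y + (1 - mh_accept g x y) * h x) \<partial>Q x)"
    using h01 mh_accept_nonneg[of g, OF g0] mh_accept_le_1[of g]
    by (subst nn_integral_mh_kernel[OF setsQ g])
       (auto intro!: nn_integral_cong simp: ennreal_mult ennreal_plus)
  also have "enn2real \<dots> = (\<integral>y. mh_accept g x y * h y + (1 - mh_accept g x y) * h x \<partial>Q x)"
    using h01 mh_accept_nonneg[of g, OF g0] mh_accept_le_1[of g]
    by (intro integral_eq_nn_integral[symmetric]) auto
  finally show ?thesis .
qed

text \<open>A positive limit at \<open>x\<close> makes \<open>g n x\<close> eventually positive, so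
  the convention for a vanishing denominator does not affect the limit.\<close>

lemma mh_accept_tendsto:
  assumes "(\<lambda>n. g n x) \<longlonglongrightarrow> \<phi> x" "(\<lambda>n. g n y) \<longlonglongrightarrow> \<phi> y" "0 < \<phi> x"
  shows "(\<lambda>n. mh_accept (g n) x y) \<longlonglongrightarrow> mh_accept \<phi> x y"
proof -
  have "(\<lambda>n. min 1 (g n y / g n x)) \<longlonglongrightarrow> min 1 (\<phi> y / \<phi> x)"
    using assms by (intro tendsto_intros) auto
  moreover have "\<forall>\<^sub>F n in sequentially. 0 < g n x"
    using assms by (intro order_tendstoD(1)) auto
  ultimately show ?thesis
    using assms(3) unfolding mh_accept_def
    by (auto elim!: Lim_transform_eventually eventually_mono)
qed

text \<open>With the same proposal, the integrands differ by the difference of acceptance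
  probabilities times \<open>h n y - h n x\<close>. The resulting bound does not involve
  \<open>h\<close>, so the test functions may change with \<open>n\<close>; it vanishes by dominated
  convergence.\<close>

lemma mh_kernel_tendsto:
  assumes Q: "Q \<in> borel \<rightarrow>\<^sub>M prob_algebra borel"
    and g[measurable]: "\<And>n. g n \<in> borel_measurable borel" and g0: "\<And>n x. 0 \<le> g n x"
    and \<phi>[measurable]: "\<phi> \<in> borel_measurable borel" and \<phi>0: "\<And>x. 0 < \<phi> x"
    and lim: "\<And>x. (\<lambda>n. g n x) \<longlonglongrightarrow> \<phi> x"
    and h[measurable]: "\<And>n. h n \<in> borel_measurable borel" and h01: "\<And>n y. h n y \<in> {0..1::real}"
  shows "(\<lambda>n. (\<integral>y. h n y \<partial>mh_kernel Q (g n) x) - (\<integral>y. h n y \<partial>mh_kernel Q \<phi> x)) \<longlonglongrightarrow> 0"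
proof (rule Lim_null_comparison)
  note setsQ[measurable_cong] = prob_algebra_kernelD(2)[OF Q, simplified]
  interpret prob_space "Q x" using prob_algebra_kernelD(1)[OF Q] by simp
  let ?D = "\<lambda>n y. \<bar>mh_accept (g n) x y - mh_accept \<phi> x y\<bar>"
  have \<phi>0': "0 \<le> \<phi> x" for x using \<phi>0[of x] by simp
  have acc: "0 \<le> mh_accept (g n) x y" "0 \<le> mh_accept \<phi> x y" "mh_accept (g n) x y \<le> 1" "mh_accept \<phi> x y \<le> 1" for n y
    using mh_accept_nonneg[of "g n", OF g0] mh_accept_nonneg[of \<phi>, OF \<phi>0'] mh_accept_le_1 by auto
  have D1: "?D n y \<le> 1" for n y using acc(1,3)[of n y] acc(2,4)[of y] by linarith
  have mix: "\<bar>a * u + (1 - a) * v\<bar> \<le> 1" if "0 \<le> a" "a \<le> 1" "u \<in> {0..1}" "v \<in> {0..1}" for a u v :: real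
  proof -
    have "a * u + (1 - a) * v \<le> a * 1 + (1 - a) * 1"
      using that by (intro add_mono mult_left_mono) auto
    moreover have "0 \<le> a * u + (1 - a) * v" using that by auto
    ultimately show ?thesis by simp
  qed
  have "(\<lambda>n. \<integral>y. ?D n y \<partial>Q x) \<longlonglongrightarrow> (\<integral>y. 0 \<partial>Q x)"
  proof (rule integral_dominated_convergence[where w = "\<lambda>_. 1"])
    show "AE y in Q x. (\<lambda>n. ?D n y) \<longlonglongrightarrow> 0"
      using mh_accept_tendsto[of g x \<phi>, OF lim lim \<phi>0] by (auto simp: tendsto_rabs_zero_iff LIM_zero_iff)
  qed (use D1 in auto)
  then show "(\<lambda>n. \<integral>y. ?D n y \<partial>Q x) \<longlonglongrightarrow> 0" by simp
  show "\<forall>\<^sub>F n in sequentially. norm ((\<integral>y. h n y \<partial>mh_kernel Q (g n) x) - (\<integral>y. h n y \<partial>mh_kernel Q \<phi> x))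
      \<le> (\<integral>y. ?D n y \<partial>Q x)"
  proof (rule always_eventually, rule allI)
    fix n
    let ?I = "\<lambda>a y. a x y * h n y + (1 - a x y) * h n x"
    have int: "integrable (Q x) (?I (mh_accept (g n)))" "integrable (Q x) (?I (mh_accept \<phi>))"
      using mix[OF acc(1,3) h01 h01] mix[OF acc(2,4) h01 h01]
      by (auto intro!: integrable_const_bound[where B = 1] AE_I2 simp del: atLeastAtMost_iff)
    have "norm ((\<integral>y. h n y \<partial>mh_kernel Q (g n) x) - (\<integral>y. h n y \<partial>mh_kernel Q \<phi> x))
       = norm (\<integral>y. ?I (mh_accept (g n)) y - ?I (mh_accept \<phi>) y \<partial>Q x)"
      unfolding integral_mh_kernel[OF Q g g0 h h01] integral_mh_kernel[OF Q \<phi> \<phi>0' h h01]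
      by (subst Bochner_Integration.integral_diff[OF int]) simp
    also have "\<dots> \<le> (\<integral>y. norm (?I (mh_accept (g n)) y - ?I (mh_accept \<phi>) y) \<partial>Q x)"
      by (rule integral_norm_bound)
    also have "\<dots> \<le> (\<integral>y. ?D n y \<partial>Q x)"
    proof (rule integral_mono)
      show "integrable (Q x) (\<lambda>y. norm (?I (mh_accept (g n)) y - ?I (mh_accept \<phi>) y))"
        using int by (intro integrable_norm Bochner_Integration.integrable_diff)
      show "integrable (Q x) (?D n)"
        using D1 by (intro integrable_const_bound[where B = 1] AE_I2) auto
      fix y
      have "?I (mh_accept (g n)) y - ?I (mh_accept \<phi>) y = (mh_accept (g n) x y - mh_accept \<phi> x y) * (h n y - h n x)"
        by (simp add: algebra_simps)
      moreover have "\<bar>h n y - h n x\<bar> \<le> 1" using h01[of n x] h01[of n y] by auto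
      ultimately show "norm (?I (mh_accept (g n)) y - ?I (mh_accept \<phi>) y) \<le> ?D n y"
        by (simp add: abs_mult mult_left_le)
    qed
    finally show "norm ((\<integral>y. h n y \<partial>mh_kernel Q (g n) x) - (\<integral>y. h n y \<partial>mh_kernel Q \<phi> x))
      \<le> (\<integral>y. ?D n y \<partial>Q x)" .
  qed
qed

subsection \<open>Path laws\<close>

lemma measurable_path_extend [measurable]:
  "(\<lambda>(\<omega>, y). \<lambda>i\<in>{..Suc T}. if i = Suc T then y else \<omega> i)
    \<in> path_space T \<Otimes>\<^sub>M borel \<rightarrow>\<^sub>M path_space (Suc T)"
  unfolding case_prod_beta
proof (rule measurable_restrict)
  fix i assume "i \<in> {..Suc T}"
  then show "(\<lambda>p. if i = Suc T then snd p else fst p i) \<in> path_space T \<Otimes>\<^sub>M borel \<rightarrow>\<^sub>M borel"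
    by (cases "i = Suc T") auto
qed

lemma measurable_path_step:
  assumes K: "K \<in> borel \<rightarrow>\<^sub>M prob_algebra borel"
  shows "(\<lambda>\<omega>. distr (K (\<omega> T)) (path_space (Suc T)) (\<lambda>y. \<lambda>i\<in>{..Suc T}. if i = Suc T then y else \<omega> i))
    \<in> path_space T \<rightarrow>\<^sub>M prob_algebra (path_space (Suc T))"
  by (rule measurable_distr_prob_space2[OF measurable_compose[OF _ K]]) measurable

lemma path_law_in_prob_algebra:
  assumes K: "K \<in> borel \<rightarrow>\<^sub>M prob_algebra borel"
  shows "path_law K x T \<in> space (prob_algebra (path_space T))"
proof (induction T)
  case 0
  have "(\<lambda>i\<in>{..0}. x) \<in> space (path_space 0)" by (simp add: space_PiM)
  then show ?case
    by (simp add: space_prob_algebra prob_space_return)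
next
  case (Suc T)
  from prob_space_bind'[OF this measurable_path_step[OF K]] sets_bind'[OF this measurable_path_step[OF K]]
  show ?case by (simp add: space_prob_algebra)
qed

text \<open>Here \<open>H\<close> averages out the last coordinate given the path up to time
  \<open>T\<close>. It is again a measurable function into the unit interval, which lets an
  induction on \<open>T\<close> continue with \<open>H\<close> as test function.\<close>

lemma integral_path_law_Suc:
  assumes K: "K \<in> borel \<rightarrow>\<^sub>M prob_algebra borel"
    and h[measurable]: "h \<in> borel_measurable (path_space (Suc T))" and h01: "\<And>\<omega>. h \<omega> \<in> {0..1::real}"
  defines "H \<equiv> \<lambda>\<omega>. \<integral>y. h (\<lambda>i\<in>{..Suc T}. if i = Suc T then y else \<omega> i) \<partial>K (\<omega> T)"
  shows "(\<integral>\<omega>. h \<omega> \<partial>path_law K x (Suc T)) = (\<integral>\<omega>. H \<omega> \<partial>path_law K x T)"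
    and "H \<in> borel_measurable (path_space T)" and "H \<omega> \<in> {0..1}"
proof -
  let ?e = "\<lambda>\<omega> y. \<lambda>i\<in>{..Suc T}. if i = Suc T then y else \<omega> i"
  interpret K: prob_space "K y" for y using prob_algebra_kernelD(1)[OF K] by simp
  interpret P: prob_space "path_law K x T" using path_law_in_prob_algebra[OF K] by (simp add: space_prob_algebra)
  have setsP[measurable_cong]: "sets (path_law K x T) = sets (path_space T)" for T
    using path_law_in_prob_algebra[OF K] by (simp add: space_prob_algebra)
  have setsK[measurable_cong]: "sets (K y) = sets borel" for y
    using prob_algebra_kernelD(2)[OF K] by simp
  have [measurable]: "?e \<omega> \<in> borel \<rightarrow>\<^sub>M path_space (Suc T)" if "\<omega> \<in> space (path_space T)" for \<omega>
    using measurable_compose[OF measurable_Pair1'[OF that] measurable_path_extend] by simp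
  have H_nn: "(\<integral>\<^sup>+y. ennreal (h (?e \<omega> y)) \<partial>K (\<omega> T)) = ennreal (H \<omega>)" if [measurable]: "\<omega> \<in> space (path_space T)" for \<omega>
    unfolding H_def using h01
    by (intro nn_integral_eq_integral K.integrable_const_bound[where B = 1] AE_I2) auto
  show H01: "H \<omega> \<in> {0..1}" for \<omega>
  proof -
    have "H \<omega> \<le> 1"
    \<comment> \<open>The bound is claimed for every \<open>\<omega>\<close>, also outside the path
      space, where the integrand might fail to be measurable; the integral then has the default
      value 0.\<close>
    proof (cases "integrable (K (\<omega> T)) (\<lambda>y. h (?e \<omega> y))")
      case True
      then show ?thesis unfolding H_def using h01 by (intro K.integral_le_const AE_I2) auto
    qed (simp add: H_def not_integrable_integral_eq)
    moreover have "0 \<le> H \<omega>" unfolding H_def using h01 by (intro integral_nonneg_AE) auto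
    ultimately show ?thesis by simp
  qed
  show Hm: "H \<in> borel_measurable (path_space T)"
  proof -
    have "(\<lambda>(\<omega>, y). ennreal (h (?e \<omega> y))) \<in> borel_measurable (path_space T \<Otimes>\<^sub>M borel)"
      using measurable_compose[OF measurable_path_extend h]
      unfolding case_prod_beta by measurable
    moreover have "(\<lambda>\<omega>. K (\<omega> T)) \<in> path_space T \<rightarrow>\<^sub>M subprob_algebra borel"
      by (rule measurable_compose[OF _ measurable_prob_algebraD[OF K]]) simp
    ultimately have "(\<lambda>\<omega>. \<integral>\<^sup>+y. ennreal (h (?e \<omega> y)) \<partial>K (\<omega> T)) \<in> borel_measurable (path_space T)"
      by (rule nn_integral_measurable_subprob_algebra2)
    moreover have "H \<omega> = enn2real (\<integral>\<^sup>+y. ennreal (h (?e \<omega> y)) \<partial>K (\<omega> T))" if "\<omega> \<in> space (path_space T)" for \<omega>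
      using H_nn[OF that] H01[of \<omega>] by simp
    ultimately show ?thesis by (simp cong: measurable_cong)
  qed
  have "(\<integral>\<omega>. h \<omega> \<partial>path_law K x (Suc T)) = enn2real (\<integral>\<^sup>+\<omega>. ennreal (h \<omega>) \<partial>path_law K x (Suc T))"
    using h01 by (intro integral_eq_nn_integral) (auto simp del: path_law.simps)
  also have "(\<integral>\<^sup>+\<omega>. ennreal (h \<omega>) \<partial>path_law K x (Suc T))
      = (\<integral>\<^sup>+\<omega>. \<integral>\<^sup>+\<omega>'. ennreal (h \<omega>') \<partial>distr (K (\<omega> T)) (path_space (Suc T)) (?e \<omega>) \<partial>path_law K x T)"
    unfolding path_law.simps
    using measurable_prob_algebraD[OF measurable_path_step[OF K]]
    by (intro nn_integral_bind[where B = "path_space (Suc T)"]) (auto cong: measurable_cong_sets)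
  also have "\<dots> = (\<integral>\<^sup>+\<omega>. ennreal (H \<omega>) \<partial>path_law K x T)"
    by (intro nn_integral_cong, subst nn_integral_distr) (auto simp: H_nn sets_eq_imp_space_eq[OF setsP])
  also have "enn2real \<dots> = (\<integral>\<omega>. H \<omega> \<partial>path_law K x T)"
    using Hm H01 by (intro integral_eq_nn_integral[symmetric]) auto
  finally show "(\<integral>\<omega>. h \<omega> \<partial>path_law K x (Suc T)) = (\<integral>\<omega>. H \<omega> \<partial>path_law K x T)" .
qed

text \<open>At time 0 both laws are the same point mass. In the step, the difference splits into a
  change of the last transition, averaged over the limit path law, and a change of the earlier path
  law; dominated convergence treats the first and the induction hypothesis the second.\<close>

lemma path_law_tendsto:
  assumes Ks: "\<And>n. Ks n \<in> borel \<rightarrow>\<^sub>M prob_algebra borel" and K: "K \<in> borel \<rightarrow>\<^sub>M prob_algebra borel"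
    and lim: "\<And>x h. (\<And>n. h n \<in> borel_measurable borel) \<Longrightarrow> (\<And>n y. h n y \<in> {0..1::real}) \<Longrightarrow>
      (\<lambda>n. (\<integral>y. h n y \<partial>Ks n x) - (\<integral>y. h n y \<partial>K x)) \<longlonglongrightarrow> 0"
    and h: "\<And>n. h n \<in> borel_measurable (path_space T)" and h01: "\<And>n \<omega>. h n \<omega> \<in> {0..1::real}"
  shows "(\<lambda>n. (\<integral>\<omega>. h n \<omega> \<partial>path_law (Ks n) x T) - (\<integral>\<omega>. h n \<omega> \<partial>path_law K x T)) \<longlonglongrightarrow> 0"
  using h h01
proof (induction T arbitrary: h)
  case 0
  then show ?case by simp
next
  case (Suc T)
  let ?e = "\<lambda>\<omega> y. \<lambda>i\<in>{..Suc T}. if i = Suc T then y else \<omega> i"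
  let ?H = "\<lambda>K n \<omega>. \<integral>y. h n (?e \<omega> y) \<partial>K (\<omega> T)"
  note h = Suc.prems
  interpret P: prob_space "path_law K x T"
    using path_law_in_prob_algebra[OF K] by (simp add: space_prob_algebra)
  have setsP[measurable_cong]: "sets (path_law K x T) = sets (path_space T)"
    using path_law_in_prob_algebra[OF K] by (simp add: space_prob_algebra)
  have meas[measurable]: "?H (Ks n) n \<in> borel_measurable (path_space T)"
    "?H K n \<in> borel_measurable (path_space T)" for n
    by (rule integral_path_law_Suc(2)[OF Ks h(1,2)] integral_path_law_Suc(2)[OF K h(1,2)])+
  have bd: "?H (Ks n) n \<omega> \<in> {0..1}" "?H K n \<omega> \<in> {0..1}" for n \<omega>
    by (rule integral_path_law_Suc(3)[OF Ks h(1,2)] integral_path_law_Suc(3)[OF K h(1,2)])+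
  have int: "integrable (path_law K x T) (?H (Ks n) n)" "integrable (path_law K x T) (?H K n)" for n
    using bd meas by (auto intro!: P.integrable_const_bound[where B = 1] AE_I2 simp del: path_law.simps)
  have "(\<lambda>n. \<integral>\<omega>. ?H (Ks n) n \<omega> - ?H K n \<omega> \<partial>path_law K x T) \<longlonglongrightarrow> (\<integral>\<omega>. 0 \<partial>path_law K x T)"
  proof (rule integral_dominated_convergence[where w = "\<lambda>_. 1"])
    show "AE \<omega> in path_law K x T. (\<lambda>n. ?H (Ks n) n \<omega> - ?H K n \<omega>) \<longlonglongrightarrow> 0"
    proof (rule AE_I2)
      fix \<omega> assume "\<omega> \<in> space (path_law K x T)"
      then have \<omega>: "\<omega> \<in> space (path_space T)" by (simp add: sets_eq_imp_space_eq[OF setsP])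
      have "?e \<omega> \<in> borel \<rightarrow>\<^sub>M path_space (Suc T)"
        using measurable_compose[OF measurable_Pair1'[OF \<omega>] measurable_path_extend] by simp
      then show "(\<lambda>n. ?H (Ks n) n \<omega> - ?H K n \<omega>) \<longlonglongrightarrow> 0"
        using h by (intro lim) (auto intro: measurable_compose)
    qed
    show "AE \<omega> in path_law K x T. norm (?H (Ks n) n \<omega> - ?H K n \<omega>) \<le> 1" for n
    proof (rule AE_I2)
      show "norm (?H (Ks n) n \<omega> - ?H K n \<omega>) \<le> 1" for \<omega>
        using bd(1)[of n \<omega>] bd(2)[of \<omega> n] unfolding real_norm_def atLeastAtMost_iff by linarith
    qed
  qed auto
  then have "(\<lambda>n. (\<integral>\<omega>. ?H (Ks n) n \<omega> \<partial>path_law K x T) - (\<integral>\<omega>. ?H K n \<omega> \<partial>path_law K x T)) \<longlonglongrightarrow> 0"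
    using int by simp
  \<comment> \<open>The test function averages over the \<open>n\<close>-th kernel and so varies
    with \<open>n\<close>; the induction is therefore general in the sequence
    \<open>h\<close>.\<close>
  moreover have "(\<lambda>n. (\<integral>\<omega>. ?H (Ks n) n \<omega> \<partial>path_law (Ks n) x T) - (\<integral>\<omega>. ?H (Ks n) n \<omega> \<partial>path_law K x T)) \<longlonglongrightarrow> 0"
    by (rule Suc.IH[OF meas(1) bd(1)])
  ultimately show ?case
    unfolding integral_path_law_Suc(1)[OF Ks h(1,2)] integral_path_law_Suc(1)[OF K h(1,2)]
    by (auto dest: tendsto_add)
qed

section \<open>Rescaling the chain\<close>

text \<open>Dilating every coordinate of a Markov chain gives the Markov chain whose kernel is
  conjugated by the dilation: scale back, take a step, scale again.\<close>

lemma distr_path_law_scaleR: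
  fixes s :: real
  assumes K: "K \<in> borel \<rightarrow>\<^sub>M prob_algebra borel" and s: "s \<noteq> 0"
  shows "distr (path_law K x T) (path_space T) (\<lambda>\<omega>. \<lambda>i\<in>{..T}. s *\<^sub>R \<omega> i)
    = path_law (\<lambda>y. distr (K ((1 / s) *\<^sub>R y)) borel (\<lambda>z. s *\<^sub>R z)) (s *\<^sub>R x) T"
proof (induction T)
  case 0
  have "(\<lambda>i\<in>{..0}. x) \<in> space (path_space 0)" by (simp add: space_PiM)
  moreover have "(\<lambda>\<omega>. \<lambda>i\<in>{..0}. s *\<^sub>R \<omega> i) \<in> path_space 0 \<rightarrow>\<^sub>M path_space 0"
    by measurable
  ultimately have "distr (path_law K x 0) (path_space 0) (\<lambda>\<omega>. \<lambda>i\<in>{..0}. s *\<^sub>R \<omega> i)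
      = return (path_space 0) (\<lambda>i\<in>{..0}. s *\<^sub>R (\<lambda>i\<in>{..0}. x) i)"
    unfolding path_law.simps by (intro distr_return)
  also have "(\<lambda>i\<in>{..0}. s *\<^sub>R (\<lambda>i\<in>{..0}. x) i) = (\<lambda>i\<in>{..0}. s *\<^sub>R x)"
    by (auto simp: restrict_def)
  finally show ?case unfolding path_law.simps .
next
  case (Suc T)
  let ?K' = "\<lambda>y. distr (K ((1 / s) *\<^sub>R y)) borel (\<lambda>z. s *\<^sub>R z)"
  let ?e = "\<lambda>\<omega> y. \<lambda>i\<in>{..Suc T}. if i = Suc T then y else \<omega> i"
  let ?S = "\<lambda>T \<omega>. \<lambda>i\<in>{..T}. s *\<^sub>R \<omega> i"
  have K': "?K' \<in> borel \<rightarrow>\<^sub>M prob_algebra borel"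
    by (rule measurable_distr_prob_space2[OF measurable_compose[OF _ K]]) measurable
  have P: "path_law K x T \<in> space (prob_algebra (path_space T))"
    by (rule path_law_in_prob_algebra[OF K])
  then have setsP[measurable_cong]: "sets (path_law K x T) = sets (path_space T)"
    by (simp add: space_prob_algebra)
  have ne: "space (path_law K x T) \<noteq> {}"
    using P by (auto simp: space_prob_algebra prob_space.not_empty)
  have setsK[measurable_cong]: "sets (K y) = sets borel" for y
    using prob_algebra_kernelD(2)[OF K] by simp
  have S[measurable]: "?S T \<in> path_space T \<rightarrow>\<^sub>M path_space T" for T
    by measurable
  have step: "(\<lambda>\<omega>. distr (K (\<omega> T)) (path_space (Suc T)) (?e \<omega>))
      \<in> path_law K x T \<rightarrow>\<^sub>M subprob_algebra (path_space (Suc T))"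
    using measurable_prob_algebraD[OF measurable_path_step[OF K]] setsP by (simp cong: measurable_cong_sets)
  have "distr (path_law K x (Suc T)) (path_space (Suc T)) (?S (Suc T))
    = path_law K x T \<bind> (\<lambda>\<omega>. distr (distr (K (\<omega> T)) (path_space (Suc T)) (?e \<omega>)) (path_space (Suc T)) (?S (Suc T)))"
    unfolding path_law.simps by (rule distr_bind[OF step ne S])
  also have "\<dots> = path_law K x T \<bind> (\<lambda>\<omega>. distr (?K' (?S T \<omega> T)) (path_space (Suc T)) (?e (?S T \<omega>)))"
  proof (rule bind_cong[OF refl])
    fix \<omega> assume "\<omega> \<in> space (path_law K x T)"
    then have \<omega>: "\<omega> \<in> space (path_space T)" by (simp add: sets_eq_imp_space_eq[OF setsP])
    have e: "?e \<omega> \<in> borel \<rightarrow>\<^sub>M path_space (Suc T)" if "\<omega> \<in> space (path_space T)" for \<omega>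
      using measurable_compose[OF measurable_Pair1'[OF that] measurable_path_extend] by simp
    note [measurable] = e[OF \<omega>] e[OF measurable_space[OF S \<omega>]]
    have "distr (distr (K (\<omega> T)) (path_space (Suc T)) (?e \<omega>)) (path_space (Suc T)) (?S (Suc T))
      = distr (K (\<omega> T)) (path_space (Suc T)) (?S (Suc T) \<circ> ?e \<omega>)"
      by (rule distr_distr) measurable
    \<comment> \<open>Appending a point and then dilating agrees with dilating both the point and
      the old path and then appending.\<close>
    also have "?S (Suc T) \<circ> ?e \<omega> = ?e (?S T \<omega>) \<circ> (\<lambda>z. s *\<^sub>R z)"
      by (auto simp: fun_eq_iff restrict_def)
    also have "distr (K (\<omega> T)) (path_space (Suc T)) \<dots>
      = distr (distr (K (\<omega> T)) borel (\<lambda>z. s *\<^sub>R z)) (path_space (Suc T)) (?e (?S T \<omega>))"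
      by (rule distr_distr[symmetric]) measurable
    also have "distr (K (\<omega> T)) borel (\<lambda>z. s *\<^sub>R z) = ?K' (?S T \<omega> T)"
      using s by simp
    finally show "distr (distr (K (\<omega> T)) (path_space (Suc T)) (?e \<omega>)) (path_space (Suc T)) (?S (Suc T))
      = distr (?K' (?S T \<omega> T)) (path_space (Suc T)) (?e (?S T \<omega>))" .
  qed
  also have "\<dots> = distr (path_law K x T) (path_space T) (?S T) \<bind>
      (\<lambda>\<omega>. distr (?K' (\<omega> T)) (path_space (Suc T)) (?e \<omega>))"
    by (rule bind_distr[symmetric, OF _ measurable_prob_algebraD[OF measurable_path_step[OF K']] ne]) measurable
  also have "\<dots> = path_law ?K' (s *\<^sub>R x) (Suc T)"
    unfolding path_law.simps Suc.IH ..
  finally show ?case .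
qed

lemma measurable_scaled_kernel:
  assumes "L \<in> borel \<rightarrow>\<^sub>M prob_algebra borel"
  shows "scaled_kernel L s \<in> borel \<rightarrow>\<^sub>M prob_algebra borel"
  unfolding scaled_kernel_def[abs_def]
  by (rule measurable_distr_prob_space2[OF measurable_compose[OF _ assms]]) measurable

text \<open>Conjugation undoes the dilation built into \<open>scaled_kernel\<close>, so the proposal
  is \<open>L\<close> again and the scale survives only in the argument of the target.\<close>

lemma distr_mh_kernel_scaled_kernel:
  assumes L: "L \<in> borel \<rightarrow>\<^sub>M prob_algebra borel" and f[measurable]: "f \<in> borel_measurable borel" and s: "s \<noteq> 0"
  shows "distr (mh_kernel (scaled_kernel L s) f ((1 / s) *\<^sub>R y)) borel (\<lambda>z. s *\<^sub>R z)
    = mh_kernel L (\<lambda>z. f ((1 / s) *\<^sub>R z)) y"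
proof (rule measure_eqI)
  have setsL[measurable_cong]: "sets (L y) = sets borel" for y
    using prob_algebra_kernelD(2)[OF L] by simp
  have setsS: "sets (scaled_kernel L s y) = sets borel" for y
    by (simp add: scaled_kernel_def)
  fix A assume "A \<in> sets (distr (mh_kernel (scaled_kernel L s) f ((1 / s) *\<^sub>R y)) borel (\<lambda>z. s *\<^sub>R z))"
  then have A[measurable]: "A \<in> sets borel" by simp
  let ?A = "(\<lambda>z. s *\<^sub>R z) -` A"
  have A'[measurable]: "?A \<in> sets borel"
    using measurable_sets[OF _ A, of "\<lambda>z. s *\<^sub>R z" borel] by simp
  have "emeasure (distr (mh_kernel (scaled_kernel L s) f ((1 / s) *\<^sub>R y)) borel (\<lambda>z. s *\<^sub>R z)) A
    = emeasure (mh_kernel (scaled_kernel L s) f ((1 / s) *\<^sub>R y)) ?A"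
    by (subst emeasure_distr) auto
  also have "\<dots> = (\<integral>\<^sup>+z. ennreal (mh_accept f ((1 / s) *\<^sub>R y) ((1 / s) *\<^sub>R z)) * indicator A z
      + ennreal (1 - mh_accept f ((1 / s) *\<^sub>R y) ((1 / s) *\<^sub>R z)) * indicator A y \<partial>L y)"
    unfolding emeasure_mh_kernel[of "scaled_kernel L s", OF setsS f A']
    unfolding scaled_kernel_def using s
    by (subst nn_integral_distr) (auto intro!: nn_integral_cong simp: indicator_def)
  also have "\<dots> = emeasure (mh_kernel L (\<lambda>z. f ((1 / s) *\<^sub>R z)) y) A"
    by (subst emeasure_mh_kernel[of L, OF setsL _ A]) (auto simp: mh_accept_def)
  finally show "emeasure (distr (mh_kernel (scaled_kernel L s) f ((1 / s) *\<^sub>R y)) borel (\<lambda>z. s *\<^sub>R z)) A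
    = emeasure (mh_kernel L (\<lambda>z. f ((1 / s) *\<^sub>R z)) y) A" .
qed simp

section \<open>Tail suprema and the final assembly\<close>

lemma SUP_tail_abs_tendsto_0:
  fixes a :: "nat \<Rightarrow> real"
  assumes "a \<longlonglongrightarrow> 0"
  shows "(\<lambda>N. SUP n\<in>{N..}. \<bar>a n\<bar>) \<longlonglongrightarrow> 0"
proof (rule LIMSEQ_I)
  fix e :: real assume "0 < e"
  then obtain N where N: "\<And>n. N \<le> n \<Longrightarrow> \<bar>a n\<bar> < e / 2"
    using LIMSEQ_D[OF assms, of "e / 2"] by auto
  have "norm ((SUP n\<in>{M..}. \<bar>a n\<bar>) - 0) < e" if "N \<le> M" for M
  proof -
    \<comment> \<open>This bound also shows that the set is bounded above, as the real supremum
      requires. Half of \<open>e\<close> is used since a supremum preserves only the weak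
      inequality.\<close>
    have bound: "\<bar>a n\<bar> \<le> e / 2" if "n \<in> {M..}" for n
      using N[of n] that \<open>N \<le> M\<close> by auto
    then have "(SUP n\<in>{M..}. \<bar>a n\<bar>) \<le> e / 2" by (intro cSUP_least) auto
    moreover have "\<bar>a M\<bar> \<le> (SUP n\<in>{M..}. \<bar>a n\<bar>)"
      using bound by (intro cSUP_upper bdd_aboveI2[where M = "e / 2"]) auto
    ultimately show ?thesis using \<open>0 < e\<close> abs_ge_zero[of "a M"] unfolding real_norm_def by linarith
  qed
  then show "\<exists>N. \<forall>M\<ge>N. norm ((SUP n\<in>{M..}. \<bar>a n\<bar>) - 0) < e" by blast
qed

theorem mainTheorem10:
  fixes \<phi>s :: "nat \<Rightarrow> 'a::euclidean_space \<Rightarrow> real"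
    and \<phi> :: "'a \<Rightarrow> real"
    and s :: "nat \<Rightarrow> real"
    and L :: "'a \<Rightarrow> 'a measure"
    and T :: nat and x :: 'a
  assumes dens_n: "\<And>n. is_density (\<phi>s n)"
    and dens: "is_density \<phi>"
    and s_pos: "\<And>n. s n > 0"
    and logconc: "\<And>n. log_concave (\<phi>s n)"
    and s_lim: "filterlim s at_top sequentially"
    and conv: "conv_in_distribution
                 (\<lambda>n. distr (density_measure (\<phi>s n)) borel (\<lambda>z. s n *\<^sub>R z))
                 (density_measure \<phi>)"
    and cont: "continuous_on (closure {z. 0 < \<phi> z}) \<phi>"
    and pos: "\<And>X. compact X \<Longrightarrow> X \<noteq> {} \<Longrightarrow> (INF z\<in>X. \<phi> z) > 0"
    and L_kernel: "L \<in> borel \<rightarrow>\<^sub>M prob_algebra borel"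
    and L_sym: "symmetric_kernel L"
  shows "\<forall>A \<in> sets (path_space T).
    (\<lambda>N0. SUP n\<in>{N0..}.
        \<bar>measure (distr (path_law (mh_kernel (scaled_kernel L (s n)) (\<phi>s n)) ((1 / s n) *\<^sub>R x) T)
                         (path_space T) (\<lambda>\<omega>. \<lambda>i\<in>{..T}. s n *\<^sub>R \<omega> i)) A
         - measure (path_law (mh_kernel L \<phi>) x T) A\<bar>) \<longlonglongrightarrow> 0"
proof
  fix A :: "(nat \<Rightarrow> 'a) set" assume A: "A \<in> sets (path_space T)"
  \<comment> \<open>This is the density of the rescaled target, normalised so that weak convergence
    can be tested against Lebesgue measure.\<close>
  define G where "G n y = (1 / s n ^ DIM('a)) * \<phi>s n ((1 / s n) *\<^sub>R y)" for n y
  have \<phi>s_meas[measurable]: "\<phi>s n \<in> borel_measurable borel" and \<phi>s0: "0 \<le> \<phi>s n y" for n y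
    using dens_n[of n] by (auto simp: is_density_def)
  have \<phi>_meas[measurable]: "\<phi> \<in> borel_measurable borel" and \<phi>0: "0 \<le> \<phi> y" for y
    using dens by (auto simp: is_density_def)
  \<comment> \<open>Applying \<open>pos\<close> to a singleton gives positivity at each point; hence
    the closure in \<open>cont\<close> is the whole space.\<close>
  have \<phi>_pos: "0 < \<phi> y" for y
    using pos[of "{y}"] by simp
  have \<phi>_cont: "continuous_on UNIV \<phi>"
    using cont \<phi>_pos by simp
  have \<phi>_int: "integrable lborel \<phi>"
    using dens \<phi>0 by (intro integrableI_nonneg) (auto simp: is_density_def)
  have "(\<lambda>n. G n z) \<longlonglongrightarrow> \<phi> z" for z
  proof (rule log_concave_weak_convergence_pointwise[OF _ _ \<phi>_int _ \<phi>_cont \<phi>_pos])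
    show "integrable lborel (G n)" for n
      unfolding G_def by (rule integrable_scaled_density[OF dens_n s_pos])
    show "log_concave (G n)" for n
      unfolding G_def using s_pos[of n] by (intro log_concave_scale[OF logconc \<phi>s0]) simp
    fix f :: "'a \<Rightarrow> real" assume f: "continuous_on UNIV f" "bounded (range f)"
    then have [measurable]: "f \<in> borel_measurable borel"
      by (intro borel_measurable_continuous_onI)
    have "(\<integral>x. f x \<partial>distr (density_measure (\<phi>s n)) borel (\<lambda>z. s n *\<^sub>R z)) = (\<integral>x. f x * G n x \<partial>lborel)" for n
      unfolding G_def by (rule integral_distr_scaled_density[OF dens_n s_pos]) measurable
    moreover have "(\<integral>x. f x \<partial>density_measure \<phi>) = (\<integral>x. f x * \<phi> x \<partial>lborel)"
      using \<phi>0 by (simp add: density_measure_def integral_density mult.commute)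
    ultimately show "(\<lambda>n. \<integral>x. f x * G n x \<partial>lborel) \<longlonglongrightarrow> (\<integral>x. f x * \<phi> x \<partial>lborel)"
      using conv[unfolded conv_in_distribution_def, rule_format, of f] f by simp
  qed
  note G_lim = this
  have K: "mh_kernel L \<phi> \<in> borel \<rightarrow>\<^sub>M prob_algebra borel"
    by (rule measurable_mh_kernel[OF L_kernel \<phi>_meas \<phi>0])
  have G_meas: "G n \<in> borel_measurable borel" for n
    unfolding G_def by measurable
  have G0: "0 \<le> G n y" for n y
    using \<phi>s0 s_pos[of n] by (simp add: G_def)
  have Ks: "mh_kernel L (G n) \<in> borel \<rightarrow>\<^sub>M prob_algebra borel" for n
    by (rule measurable_mh_kernel[OF L_kernel G_meas G0])
  \<comment> \<open>The normalising factor cancels in the acceptance ratio, and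
    \<open>mh_kernel\<close> depends on its target only through \<open>mh_accept\<close>.\<close>
  have accept: "mh_accept (\<lambda>z. \<phi>s n ((1 / s n) *\<^sub>R z)) = mh_accept (G n)" for n
    using s_pos[of n] by (auto simp: fun_eq_iff mh_accept_def G_def zero_less_divide_iff)
  have scaled: "distr (path_law (mh_kernel (scaled_kernel L (s n)) (\<phi>s n)) ((1 / s n) *\<^sub>R x) T)
        (path_space T) (\<lambda>\<omega>. \<lambda>i\<in>{..T}. s n *\<^sub>R \<omega> i) = path_law (mh_kernel L (G n)) x T" for n
  proof -
    have s: "s n \<noteq> 0" using s_pos[of n] by simp
    have "mh_kernel L (\<lambda>z. \<phi>s n ((1 / s n) *\<^sub>R z)) = mh_kernel L (G n)"
      unfolding mh_kernel_def[abs_def] accept ..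
    then have "(\<lambda>y. distr (mh_kernel (scaled_kernel L (s n)) (\<phi>s n) ((1 / s n) *\<^sub>R y)) borel (\<lambda>z. s n *\<^sub>R z))
        = mh_kernel L (G n)"
      unfolding distr_mh_kernel_scaled_kernel[OF L_kernel \<phi>s_meas s] by simp
    moreover have "s n *\<^sub>R (1 / s n) *\<^sub>R x = x" using s by simp
    ultimately show ?thesis
      unfolding distr_path_law_scaleR[OF measurable_mh_kernel[OF measurable_scaled_kernel[OF L_kernel] \<phi>s_meas \<phi>s0] s]
      by simp
  qed
  have law: "(\<integral>\<omega>. indicator A \<omega> \<partial>path_law K x T) = measure (path_law K x T) A"
    if "K \<in> borel \<rightarrow>\<^sub>M prob_algebra borel" for K
  proof -
    have "sets (path_law K x T) = sets (path_space T)"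
      using path_law_in_prob_algebra[OF that] by (simp add: space_prob_algebra)
    then show ?thesis using A sets.sets_into_space[of A "path_law K x T"] by (simp add: Int_absorb2)
  qed
  have "(\<lambda>n. (\<integral>\<omega>. indicator A \<omega> \<partial>path_law (mh_kernel L (G n)) x T)
      - (\<integral>\<omega>. indicator A \<omega> \<partial>path_law (mh_kernel L \<phi>) x T)) \<longlonglongrightarrow> (0::real)"
  \<comment> \<open>The sequence of test functions is constant here, equal to the indicator of
    \<open>A\<close>.\<close>
  proof (rule path_law_tendsto[OF Ks K])
    show "(\<lambda>n. (\<integral>y. h n y \<partial>mh_kernel L (G n) x) - (\<integral>y. h n y \<partial>mh_kernel L \<phi> x)) \<longlonglongrightarrow> 0"
      if "\<And>n. h n \<in> borel_measurable borel" "\<And>n y. h n y \<in> {0..1::real}" for x h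
      by (rule mh_kernel_tendsto[OF L_kernel G_meas G0 \<phi>_meas \<phi>_pos G_lim that])
  qed (use A in \<open>auto simp: indicator_def\<close>)
  then show "(\<lambda>N0. SUP n\<in>{N0..}.
        \<bar>measure (distr (path_law (mh_kernel (scaled_kernel L (s n)) (\<phi>s n)) ((1 / s n) *\<^sub>R x) T)
                         (path_space T) (\<lambda>\<omega>. \<lambda>i\<in>{..T}. s n *\<^sub>R \<omega> i)) A
         - measure (path_law (mh_kernel L \<phi>) x T) A\<bar>) \<longlonglongrightarrow> 0"
    unfolding scaled law[OF Ks] law[OF K] by (rule SUP_tail_abs_tendsto_0)
qed

end
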